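(* Let $G$ be a simple undirected graph, $H$ a set of $\rho$ edges between vertices of $G$ not in $E(G)$, $G'=G+H$, and $\Delta$ the maximum vertex degree of $G'$. Algorithm EnumN (described in the context) outputs every clique of $\Lambda^{new}(G,G')$ exactly once and outputs nothing else, in time $O(\Delta^3\rho\,|\Lambda^{new}(G,G')|)$, using space $O(|E(G')|+|V(G')|)$.
   Context: A clique is a set of pairwise adjacent vertices; it is maximal if not properly contained in another clique; $\mathcal{C}(X)$ is the set of maximal cliques of $X$; $\Lambda^{new}(G,G')=\mathcal{C}(G')\setminus\mathcal{C}(G)$; $\Gamma_{G'}(w)$ is the neighbourhood of $w$ in $G'$. MCE is an algorithm (Chiba–Nishizeki) that, given a graph $X$ with $n_X$ vertices, $m_X$ edges, arboricity $\alpha_X$ and $\mu_X$ maximal cliques, enumerates all maximal cliques of $X$ in time $O(\alpha_X m_X \mu_X)$ and space $O(n_X+m_X)$. Algorithm EnumN$(G,H)$: order the edges of $H$ arbitrarily as $e_1,\dots,e_\rho$; set $G'=G+H$; for $i=1,\dots,\rho$, with $e_i=(u,v)$, let $V_e=\{u,v\}\cup(\Gamma_{G'}(u)\cap\Gamma_{G'}(v))$, let $G'_e$ be the subgraph of $G'$ induced by $V_e$, run MCE$(G'_e)$, and output each generated clique $c$ only if $c$ contains no edge $e_j$ (i.e. not both endpoints of $e_j$) with $j<i$. *)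

theory Defs
  imports Main "HOL-Library.Ramsey" "HOL-Library.State_Monad"
begin

section \<open>Finite simple graphs\<close>

text \<open>A graph is a vertex set together with a set of two-element vertex sets;
  \<open>clique\<close> is taken from \<open>HOL-Library.Ramsey\<close>.\<close>

definition simple_graph :: "'a set \<Rightarrow> 'a set set \<Rightarrow> bool" where
  "simple_graph V E \<longleftrightarrow> finite V \<and> E \<subseteq> nsets V 2"

definition nbrs :: "'a set set \<Rightarrow> 'a \<Rightarrow> 'a set" where
  "nbrs E v = {w. {v, w} \<in> E}"

text \<open>The inserted \<open>0\<close> only matters for the graph without vertices.\<close>

definition max_degree :: "'a set \<Rightarrow> 'a set set \<Rightarrow> nat" where
  "max_degree V E = Max (insert 0 ((\<lambda>v. card (nbrs E v)) ` V))"

definition max_cliques :: "'a set \<Rightarrow> 'a set set \<Rightarrow> 'a set set" where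
  "max_cliques V E = {C. C \<subseteq> V \<and> clique C E \<and> \<not> (\<exists>D. D \<subseteq> V \<and> clique D E \<and> C \<subset> D)}"

text \<open>The graph \<open>G + H\<close> is \<open>(V, E \<union> H)\<close>.\<close>

definition new_cliques :: "'a set \<Rightarrow> 'a set set \<Rightarrow> 'a set set \<Rightarrow> 'a set set" where
  "new_cliques V E H = max_cliques V (E \<union> H) - max_cliques V E"

definition forest :: "'a set set \<Rightarrow> bool" where
  "forest F \<longleftrightarrow> \<not> (\<exists>p. 3 \<le> length p \<and> distinct p \<and>
     (\<forall>i<length p. {p ! i, p ! (Suc i mod length p)} \<in> F))"

definition arboricity :: "'a set set \<Rightarrow> nat" where
  "arboricity E = (LEAST k. \<exists>f. (\<forall>e\<in>E. f e < k) \<and> (\<forall>i<k. forest {e \<in> E. f e = i}))"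

text \<open>\<open>es\<close> lists the edges in \<open>H\<close>, each exactly once, in some order and with some
  order of the two endpoints.\<close>

definition edge_order :: "('a \<times> 'a) list \<Rightarrow> 'a set set \<Rightarrow> bool" where
  "edge_order es H \<longleftrightarrow> distinct (map (\<lambda>(u, v). {u, v}) es) \<and> set (map (\<lambda>(u, v). {u, v}) es) = H"


section \<open>Cost model\<close>

text \<open>
  Programs run on a unit-cost random access machine. \<open>clock\<close> counts elementary steps, \<open>used\<close>
  is the number of memory cells (of constantly many words each) currently in use, \<open>peak\<close> the
  largest value \<open>used\<close> has taken, and \<open>out\<close> the output written so far. The output is a
  write-only stream and does not occupy memory. Every iteration of a loop costs one step,
  which pays for the constantly many comparisons and pointer operations of that iteration; all
  loops below are tail recursive, so no call stack has to be accounted for. Allocating a cell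
  costs one step.
\<close>

record 'a machine =
  clock :: nat
  used :: nat
  peak :: nat
  out :: "'a list list"

type_synonym ('a, 'x) prog = "('a machine, 'x) state"

abbreviation ret :: "'x \<Rightarrow> ('a, 'x) prog" where
  "ret \<equiv> State_Monad.return"

definition charge :: "nat \<Rightarrow> ('a, unit) prog" where
  "charge n = State_Monad.update (\<lambda>s. s\<lparr>clock := clock s + n\<rparr>)"

definition reserve :: "nat \<Rightarrow> ('a, unit) prog" where
  "reserve n = State_Monad.update
     (\<lambda>s. s\<lparr>used := used s + n, peak := max (peak s) (used s + n)\<rparr>)"

definition alloc :: "nat \<Rightarrow> ('a, unit) prog" where
  "alloc n = do { charge n; reserve n }"

definition emit :: "'a list \<Rightarrow> ('a, unit) prog" where
  "emit c = do { charge (length c); State_Monad.update (\<lambda>s. s\<lparr>out := out s @ [c]\<rparr>) }"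

text \<open>All memory allocated while running \<open>p\<close> is released afterwards; this is sound
  since \<open>p\<close> does not return any data.\<close>

definition region :: "('a, unit) prog \<Rightarrow> ('a, unit) prog" where
  "region p = do {
     s \<leftarrow> State_Monad.get;
     p;
     charge 1;
     State_Monad.update (\<lambda>s'. s'\<lparr>used := used s\<rparr>) }"

primrec for_each :: "('x \<Rightarrow> ('a, unit) prog) \<Rightarrow> 'x list \<Rightarrow> ('a, unit) prog" where
  "for_each f [] = ret ()"
| "for_each f (x # xs) = do { charge 1; f x; for_each f xs }"

primrec exists_in :: "('x \<Rightarrow> ('a, bool) prog) \<Rightarrow> 'x list \<Rightarrow> ('a, bool) prog" where
  "exists_in p [] = ret False"
| "exists_in p (x # xs) = do { charge 1; b \<leftarrow> p x; if b then ret True else exists_in p xs }"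


section \<open>Adjacency lists\<close>

text \<open>
  The graph is held in an array of adjacency lists, which is updated in place. A list
  cell holds a neighbour and a label: \<open>None\<close> for an edge of \<open>G\<close>, and \<open>Some j\<close> for the
  edge at position \<open>j\<close> of the list of inserted edges. The labels make it possible to recognise
  an inserted edge without scanning the whole list of inserted edges.
\<close>

type_synonym 'a adjacency = "'a \<Rightarrow> ('a \<times> nat option) list"

definition represents :: "'a adjacency \<Rightarrow> 'a set \<Rightarrow> 'a set set \<Rightarrow> bool" where
  "represents A V E \<longleftrightarrow> (\<forall>v\<in>V. distinct (map fst (A v)) \<and> fst ` set (A v) = nbrs E v \<and>
     (\<forall>x\<in>set (A v). snd x = None))"

definition lookup :: "'a adjacency \<Rightarrow> 'a \<Rightarrow> ('a, ('a \<times> nat option) list) prog" where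
  "lookup A v = do { charge 1; ret (A v) }"

definition insert_edge :: "nat \<Rightarrow> 'a \<times> 'a \<Rightarrow> 'a adjacency \<Rightarrow> ('a, 'a adjacency) prog" where
  "insert_edge i e A = (case e of (u, v) \<Rightarrow> do {
     charge 2;
     alloc 2;
     ret (A(u := (v, Some i) # A u, v := (u, Some i) # A v)) })"

primrec insert_edges :: "nat \<Rightarrow> ('a \<times> 'a) list \<Rightarrow> 'a adjacency \<Rightarrow> ('a, 'a adjacency) prog" where
  "insert_edges i [] A = ret A"
| "insert_edges i (e # es) A = do {
     charge 1;
     A' \<leftarrow> insert_edge i e A;
     insert_edges (Suc i) es A' }"

primrec select ::
    "('a \<Rightarrow> ('a, bool) prog) \<Rightarrow> ('a \<times> nat option) list \<Rightarrow> 'a list \<Rightarrow> ('a, 'a list) prog" where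
  "select p [] acc = ret acc"
| "select p (x # xs) acc = do {
     charge 1;
     b \<leftarrow> p (fst x);
     if b then do { alloc 1; select p xs (fst x # acc) } else select p xs acc }"

text \<open>A graph passed to a subroutine is a list of vertices, each with its list of
  neighbours.\<close>

type_synonym 'a graph_list = "('a \<times> 'a list) list"

definition is_graph_list :: "'a graph_list \<Rightarrow> 'a set \<Rightarrow> 'a set set \<Rightarrow> bool" where
  "is_graph_list X V E \<longleftrightarrow> simple_graph V E \<and> distinct (map fst X) \<and> fst ` set X = V \<and>
     (\<forall>(v, ns) \<in> set X. distinct ns \<and> set ns = nbrs E v)"

text \<open>The subgraph induced by \<open>W\<close>.\<close>

primrec induced ::
    "'a adjacency \<Rightarrow> 'a list \<Rightarrow> 'a list \<Rightarrow> 'a graph_list \<Rightarrow> ('a, 'a graph_list) prog" where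
  "induced A W [] acc = ret acc"
| "induced A W (x # xs) acc = do {
     charge 1;
     cells \<leftarrow> lookup A x;
     ns \<leftarrow> select (\<lambda>y. exists_in (\<lambda>z. ret (y = z)) W) cells [];
     alloc 1;
     induced A W xs ((x, ns) # acc) }"


section \<open>The subroutine MCE\<close>

text \<open>MCE is a black box, described by what it generates on each input
  and by the number of steps and of memory cells it takes to do so.\<close>

record 'a mce_run =
  generated :: "'a list list"
  steps :: nat
  workspace :: nat

type_synonym 'a mce = "'a graph_list \<Rightarrow> 'a mce_run"

text \<open>The cost bounds are required only for graphs with at least one edge: otherwise
  \<open>arboricity E * card E * card (max_cliques V E)\<close> is \<open>0\<close>, and no actual program
  takes no steps.\<close>

definition MCE_spec :: "'a mce \<Rightarrow> bool" where
  "MCE_spec mce \<longleftrightarrow>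
     (\<forall>X V E. is_graph_list X V E \<longrightarrow>
        (\<forall>c\<in>set (generated (mce X)). distinct c) \<and>
        distinct (map set (generated (mce X))) \<and>
        set ` set (generated (mce X)) = max_cliques V E) \<and>
     (\<exists>C. \<forall>X V E. is_graph_list X V E \<and> E \<noteq> {} \<longrightarrow>
        steps (mce X) \<le> C * (arboricity E * card E * card (max_cliques V E))) \<and>
     (\<exists>C. \<forall>X V E. is_graph_list X V E \<and> E \<noteq> {} \<longrightarrow>
        workspace (mce X) \<le> C * (card V + card E))"

text \<open>Each clique is handed to \<open>k\<close> when it is generated. The whole workspace of MCE is
  regarded as occupied during the entire enumeration.\<close>

definition run_mce :: "'a mce \<Rightarrow> 'a graph_list \<Rightarrow> ('a list \<Rightarrow> ('a, unit) prog) \<Rightarrow> ('a, unit) prog" where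
  "run_mce mce X k = region (do {
     charge (steps (mce X));
     reserve (workspace (mce X));
     for_each k (generated (mce X)) })"


section \<open>The algorithm EnumN\<close>

text \<open>Positions in the list of inserted edges start at \<open>0\<close>. The following tests whether
  \<open>c\<close> contains both endpoints of an inserted edge at a position \<open>j < i\<close>.\<close>

definition contains_earlier :: "'a adjacency \<Rightarrow> nat \<Rightarrow> 'a list \<Rightarrow> ('a, bool) prog" where
  "contains_earlier A i c = exists_in (\<lambda>x. do {
     cells \<leftarrow> lookup A x;
     exists_in (\<lambda>(y, l). case l of
         None \<Rightarrow> ret False
       | Some j \<Rightarrow> if j < i then exists_in (\<lambda>z. ret (y = z)) c else ret False) cells }) c"

definition process_clique :: "'a adjacency \<Rightarrow> nat \<Rightarrow> 'a list \<Rightarrow> ('a, unit) prog" where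
  "process_clique A i c = region (do {
     alloc (length c);
     b \<leftarrow> contains_earlier A i c;
     if b then ret () else emit c })"

definition process_edge :: "'a mce \<Rightarrow> 'a adjacency \<Rightarrow> nat \<Rightarrow> 'a \<times> 'a \<Rightarrow> ('a, unit) prog" where
  "process_edge mce A i e = (case e of (u, v) \<Rightarrow> region (do {
     cu \<leftarrow> lookup A u;
     cv \<leftarrow> lookup A v;
     common \<leftarrow> select (\<lambda>y. exists_in (\<lambda>z. ret (y = fst z)) cv) cu [];
     alloc 2;
     let W = u # v # common;
     X \<leftarrow> induced A W W [];
     run_mce mce X (process_clique A i) }))"

primrec process_edges :: "'a mce \<Rightarrow> 'a adjacency \<Rightarrow> nat \<Rightarrow> ('a \<times> 'a) list \<Rightarrow> ('a, unit) prog" where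
  "process_edges mce A i [] = ret ()"
| "process_edges mce A i (e # es) = do {
     charge 1;
     process_edge mce A i e;
     process_edges mce A (Suc i) es }"

definition EnumN :: "'a mce \<Rightarrow> 'a adjacency \<Rightarrow> ('a \<times> 'a) list \<Rightarrow> ('a, unit) prog" where
  "EnumN mce A es = do {
     A' \<leftarrow> insert_edges 0 es A;
     process_edges mce A' 0 es }"

text \<open>Initially the memory holds the adjacency lists of \<open>G\<close> and the list \<open>es\<close>; the space
  they occupy is included in \<open>peak\<close>.\<close>

definition input_size :: "'a set \<Rightarrow> 'a adjacency \<Rightarrow> ('a \<times> 'a) list \<Rightarrow> nat" where
  "input_size V A es = (\<Sum>v\<in>V. 1 + length (A v)) + length es"

definition run_EnumN :: "'a mce \<Rightarrow> 'a set \<Rightarrow> 'a adjacency \<Rightarrow> ('a \<times> 'a) list \<Rightarrow> 'a machine" where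
  "run_EnumN mce V A es = snd (run_state (EnumN mce A es)
     \<lparr>clock = 0, used = input_size V A es, peak = input_size V A es, out = []\<rparr>)"

end

theory Submission
  imports Defs
begin

text \<open>The maximal cliques of the subgraph induced by \<open>u\<close>, \<open>v\<close> and their common neighbours are
  exactly the maximal cliques of \<open>G + H\<close> through \<open>u\<close> and \<open>v\<close>, and a maximal clique of \<open>G + H\<close> is
  new iff it contains an inserted edge. So every new clique is generated once for each inserted
  edge in it, and the test against earlier edges keeps it only for the first of these. The
  induced subgraph has at most \<open>\<Delta> + 1 \<le> 2 \<Delta>\<close> vertices, hence arboricity \<open>O(\<Delta>)\<close> and
  \<open>O(\<Delta>\<^sup>2)\<close> edges, and it has at most as many maximal cliques as there are new cliques;
  this bounds the cost of one run of MCE. Testing one clique also takes \<open>O(\<Delta>\<^sup>3)\<close> steps,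
  because a cell of an adjacency list leads to a scan of the clique only. The overhead that is
  independent of the number of cliques is absorbed since an inserted edge always extends to a
  new clique.\<close>

section \<open>Resource bounds for programs\<close>

text \<open>\<open>runs_within p r os t m q\<close>: \<open>p\<close> returns \<open>r\<close>, appends \<open>os\<close> to the output, takes at most
  \<open>t\<close> steps, leaves at most \<open>m\<close> more cells in use than before, and never has more than \<open>q\<close>
  additional cells in use while running.\<close>

definition runs_within ::
    "('a, 'x) prog \<Rightarrow> 'x \<Rightarrow> 'a list list \<Rightarrow> nat \<Rightarrow> nat \<Rightarrow> nat \<Rightarrow> bool" where
  "runs_within p r os t m q \<longleftrightarrow> (\<forall>s.
     fst (run_state p s) = r \<and>
     out (snd (run_state p s)) = out s @ os \<and>
     clock (snd (run_state p s)) \<le> clock s + t \<and>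
     used (snd (run_state p s)) \<le> used s + m \<and>
     peak (snd (run_state p s)) \<le> max (peak s) (used s + q))"

text \<open>Applied first in later proofs, it leaves the bounds of the program schematic: the
  composition rules fill them in, and only numeric inequalities and an equation between outputs
  remain.\<close>

lemma runs_within_weaken:
  assumes "runs_within p r os t m q" "os = os'" "t \<le> t'" "m \<le> m'" "q \<le> q'"
  shows "runs_within p r os' t' m' q'"
  unfolding runs_within_def
proof (intro allI)
  fix s
  show "fst (run_state p s) = r \<and>
     out (snd (run_state p s)) = out s @ os' \<and>
     clock (snd (run_state p s)) \<le> clock s + t' \<and>
     used (snd (run_state p s)) \<le> used s + m' \<and>
     peak (snd (run_state p s)) \<le> max (peak s) (used s + q')"
    using assms(1)[unfolded runs_within_def, rule_format, of s] assms(2-) by auto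
qed

section \<open>Primitive operations, sequencing and regions\<close>

lemma runs_within_return: "runs_within (ret x) x [] 0 0 0"
  by (simp add: runs_within_def)

lemma runs_within_charge: "runs_within (charge n) () [] n 0 0"
  by (simp add: runs_within_def charge_def State_Monad.update_def State_Monad.set_def)

lemma runs_within_reserve: "runs_within (reserve n) () [] 0 n n"
  by (simp add: runs_within_def reserve_def State_Monad.update_def State_Monad.set_def)

text \<open>The second program starts with up to \<open>m1\<close> extra cells in use, which shift
  its peak. It is considered for the single value \<open>x\<close> only, because the result of
  \<open>p\<close> does not depend on the machine state.\<close>

lemma runs_within_bind:
  assumes "runs_within p x os1 t1 m1 q1" and "runs_within (f x) y os2 t2 m2 q2"
  shows "runs_within (p \<bind> f) y (os1 @ os2) (t1 + t2) (m1 + m2) (max q1 (m1 + q2))"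
  unfolding runs_within_def
proof (intro allI)
  fix s
  obtain s1 where s1: "run_state p s = (x, s1)"
    using assms(1)[unfolded runs_within_def, rule_format, of s]
    by (cases "run_state p s") auto
  show "fst (run_state (p \<bind> f) s) = y \<and>
     out (snd (run_state (p \<bind> f) s)) = out s @ os1 @ os2 \<and>
     clock (snd (run_state (p \<bind> f) s)) \<le> clock s + (t1 + t2) \<and>
     used (snd (run_state (p \<bind> f) s)) \<le> used s + (m1 + m2) \<and>
     peak (snd (run_state (p \<bind> f) s)) \<le> max (peak s) (used s + max q1 (m1 + q2))"
    using assms(1)[unfolded runs_within_def, rule_format, of s]
      assms(2)[unfolded runs_within_def, rule_format, of s1] s1
    by auto
qed

text \<open>Usage is reset to its value on entry, so the net growth is 0 while the peak remains
  \<open>q\<close>; the extra step is the charge for the release.\<close>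

lemma runs_within_region:
  assumes "runs_within p () os t m q"
  shows "runs_within (region p) () os (t + 1) 0 q"
  unfolding runs_within_def
proof (intro allI)
  fix s
  obtain s1 where s1: "run_state p s = ((), s1)"
    by (cases "run_state p s") auto
  show "fst (run_state (region p) s) = () \<and>
     out (snd (run_state (region p) s)) = out s @ os \<and>
     clock (snd (run_state (region p) s)) \<le> clock s + (t + 1) \<and>
     used (snd (run_state (region p) s)) \<le> used s + 0 \<and>
     peak (snd (run_state (region p) s)) \<le> max (peak s) (used s + q)"
    using assms[unfolded runs_within_def, rule_format, of s] s1
    by (simp add: region_def charge_def State_Monad.update_def State_Monad.set_def)
qed

lemma runs_within_alloc: "runs_within (alloc n) () [] n n n"
  unfolding alloc_def
  by (rule runs_within_weaken, rule runs_within_bind, rule runs_within_charge,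
      rule runs_within_reserve) auto

lemma runs_within_emit: "runs_within (emit c) () [c] (length c) 0 0"
  by (simp add: runs_within_def emit_def charge_def State_Monad.update_def State_Monad.set_def)

lemma runs_within_lookup: "runs_within (lookup A v) (A v) [] 1 0 0"
  unfolding lookup_def
  by (rule runs_within_weaken, rule runs_within_bind, rule runs_within_charge,
      rule runs_within_return) auto

text \<open>Because the body retains no memory, the peak \<open>q\<close> is that of a single
  iteration and is not multiplied by the length.\<close>

lemma runs_within_for_each:
  assumes "\<And>x. x \<in> set xs \<Longrightarrow> runs_within (f x) () (os x) t 0 q"
  shows "runs_within (for_each f xs) () (concat (map os xs)) (length xs * (t + 1)) 0 q"
  using assms
proof (induction xs)
  case Nil
  show ?case
    by (simp, rule runs_within_weaken, rule runs_within_return) auto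
next
  case (Cons x xs)
  have "runs_within (f x) () (os x) t 0 q"
    using Cons.prems by simp
  moreover have "runs_within (for_each f xs) () (concat (map os xs)) (length xs * (t + 1)) 0 q"
    by (rule Cons.IH) (use Cons.prems in simp)
  ultimately show ?case
    unfolding for_each.simps
    by (intro runs_within_weaken[OF runs_within_bind[OF runs_within_charge runs_within_bind]]) auto
qed

text \<open>The bound is that of a complete scan; stopping early only saves steps.\<close>

lemma runs_within_exists_in:
  assumes "\<And>x. x \<in> set xs \<Longrightarrow> runs_within (p x) (P x) [] t 0 0"
  shows "runs_within (exists_in p xs) (\<exists>x\<in>set xs. P x) [] (length xs * (t + 1)) 0 0"
  using assms
proof (induction xs)
  case Nil
  show ?case
    by (simp add: runs_within_return)
next
  case (Cons x xs)
  have x: "runs_within (p x) (P x) [] t 0 0"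
    using Cons.prems by simp
  have xs: "runs_within (exists_in p xs) (\<exists>x\<in>set xs. P x) [] (length xs * (t + 1)) 0 0"
    by (rule Cons.IH) (use Cons.prems in simp)
  have "runs_within (if P x then ret True else exists_in p xs) (\<exists>x\<in>set (x # xs). P x) []
      (length xs * (t + 1)) 0 0"
    using xs runs_within_weaken[OF runs_within_return, of "[]" _ _ _ True] by auto
  from runs_within_bind[where f = "\<lambda>b. if b then ret True else exists_in p xs", OF x this]
  show ?case
    unfolding exists_in.simps
    by (intro runs_within_weaken[OF runs_within_bind[OF runs_within_charge]]) auto
qed

lemma runs_within_member:
  "runs_within (exists_in (\<lambda>z. ret (y = z)) xs) (y \<in> set xs) [] (length xs) 0 0"
  using runs_within_exists_in[of xs "\<lambda>z. ret (y = z)" "\<lambda>z. y = z", OF runs_within_return]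
  by (simp add: bex_cong[OF refl, of _ "\<lambda>z. y = z"])

text \<open>Beyond the test, an entry costs at most two steps: the iteration and the cell for an
  accepted entry. The accumulator reverses the order.\<close>

lemma runs_within_select:
  assumes "\<And>x. x \<in> set xs \<Longrightarrow> runs_within (p (fst x)) (P (fst x)) [] t 0 0"
  shows "runs_within (select p xs acc) (rev (filter P (map fst xs)) @ acc) []
    (length xs * (t + 2)) (length xs) (length xs)"
  using assms
proof (induction xs arbitrary: acc)
  case Nil
  show ?case
    by (simp add: runs_within_return)
next
  case (Cons x xs)
  have x: "runs_within (p (fst x)) (P (fst x)) [] t 0 0"
    using Cons.prems by simp
  have xs: "runs_within (select p xs acc') (rev (filter P (map fst xs)) @ acc') []
      (length xs * (t + 2)) (length xs) (length xs)" for acc'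
    by (rule Cons.IH) (use Cons.prems in simp)
  have "runs_within (if P (fst x) then do { alloc 1; select p xs (fst x # acc) } else select p xs acc)
      (rev (filter P (map fst (x # xs))) @ acc) []
      (1 + length xs * (t + 2)) (1 + length xs) (1 + length xs)"
  proof (cases "P (fst x)")
    case True
    then show ?thesis
      using runs_within_weaken[OF runs_within_bind[OF runs_within_alloc[of 1] xs[of "fst x # acc"]]]
      by auto
  next
    case False
    then show ?thesis
      using runs_within_weaken[OF xs[of acc]] by auto
  qed
  from runs_within_bind[where f = "\<lambda>b. if b then do { alloc 1; select p xs (fst x # acc) }
      else select p xs acc", OF x this]
  show ?case
    unfolding select.simps
    by (intro runs_within_weaken[OF runs_within_bind[OF runs_within_charge]]) auto
qed

text \<open>Time needs only the uniform bound \<open>d\<close>, but space is kept as a sum of list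
  lengths: over distinct vertices this sum is linear in the numbers of vertices and edges, whereas
  \<open>length xs * d\<close> need not be.\<close>

lemma runs_within_induced:
  assumes "\<And>x. x \<in> set xs \<Longrightarrow> length (A x) \<le> d"
  shows "runs_within (induced A W xs acc)
    (rev (map (\<lambda>x. (x, rev (filter (\<lambda>y. y \<in> set W) (map fst (A x))))) xs) @ acc) []
    (length xs * (3 + d * (length W + 2)))
    (\<Sum>x\<leftarrow>xs. 1 + length (A x)) (\<Sum>x\<leftarrow>xs. 1 + length (A x))"
  using assms
proof (induction xs arbitrary: acc)
  case Nil
  show ?case
    by (simp add: runs_within_return)
next
  case (Cons x xs)
  let ?ns = "rev (filter (\<lambda>y. y \<in> set W) (map fst (A x)))"
  have "length (A x) \<le> d"
    using Cons.prems by simp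
  then have "length (A x) * (length W + 2) \<le> d * (length W + 2)"
    by (rule mult_right_mono) simp
  then have ns: "runs_within (select (\<lambda>y. exists_in (\<lambda>z. ret (y = z)) W) (A x) []) ?ns []
      (d * (length W + 2)) (length (A x)) (length (A x))"
    using runs_within_weaken[OF runs_within_select[where p = "\<lambda>y. exists_in (\<lambda>z. ret (y = z)) W"
          and P = "\<lambda>y. y \<in> set W" and acc = "[]", OF runs_within_member]] by simp
  have xs: "runs_within (induced A W xs ((x, ?ns) # acc))
    (rev (map (\<lambda>x. (x, rev (filter (\<lambda>y. y \<in> set W) (map fst (A x))))) xs) @ (x, ?ns) # acc) []
    (length xs * (3 + d * (length W + 2)))
    (\<Sum>x\<leftarrow>xs. 1 + length (A x)) (\<Sum>x\<leftarrow>xs. 1 + length (A x))"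
    by (rule Cons.IH) (use Cons.prems in simp)
  show ?case
    unfolding induced.simps
    by (rule runs_within_weaken, rule runs_within_bind, rule runs_within_charge,
        rule runs_within_bind, rule runs_within_lookup, rule runs_within_bind, rule ns,
        rule runs_within_bind, rule runs_within_alloc, use xs in simp) auto
qed

lemma runs_within_insert_edge:
  "runs_within (insert_edge i (u, v) A) (A(u := (v, Some i) # A u, v := (u, Some i) # A v)) [] 4 2 2"
  unfolding insert_edge_def prod.case
  by (rule runs_within_weaken, rule runs_within_bind, rule runs_within_charge,
      rule runs_within_bind, rule runs_within_alloc, rule runs_within_return) auto


section \<open>Graphs and cliques\<close>

text \<open>A vertex lies on at most two edges of a cycle, so a cycle of length at least three has
  an edge avoiding \<open>c\<close>.\<close>

lemma star_imp_forest:
  assumes "\<And>e. e \<in> F \<Longrightarrow> c \<in> e"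
  shows "forest F"
  unfolding forest_def
proof (intro notI, elim exE conjE)
  fix p
  assume p: "3 \<le> length p" "distinct p" and "\<forall>i<length p. {p ! i, p ! (Suc i mod length p)} \<in> F"
  then have c: "c \<in> {p ! i, p ! (Suc i mod length p)}" if "i < length p" for i
    using assms that by blast
  \<comment> \<open>Three consecutive edges are inspected; the first two force
    \<open>c = p ! 1\<close>. In a triangle the end of the third edge wraps around to index 0, which
    still differs from 1.\<close>
  let ?k = "3 mod length p"
  have len: "0 < length p" "1 < length p" "2 < length p"
    using p(1) by linarith+
  have k: "?k < length p" "?k \<noteq> 1"
    using p(1) by (cases "length p = 3"; simp)+
  have "Suc 0 mod length p = 1" "Suc 1 mod length p = 2" "Suc 2 mod length p = ?k"
    using len by (simp_all add: numeral_eq_Suc)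
  then have "c = p ! 0 \<or> c = p ! 1" "c = p ! 1 \<or> c = p ! 2" "c = p ! 2 \<or> c = p ! ?k"
    using c[OF len(1)] c[OF len(2)] c[OF len(3)] by (simp_all only: insert_iff empty_iff simp_thms)
  moreover have "p ! 0 \<noteq> p ! 1" "p ! 0 \<noteq> p ! 2" "p ! 1 \<noteq> p ! 2" "p ! 1 \<noteq> p ! ?k"
    using nth_eq_iff_index_eq[OF p(2)] len k by (simp_all del: One_nat_def)
  ultimately show False
    by metis
qed

text \<open>The edges whose first endpoint, in a fixed enumeration of the vertices, is a given
  vertex form a star.\<close>

lemma arboricity_le:
  assumes "simple_graph V E"
  shows "arboricity E \<le> card V"
proof -
  have fin: "finite V" and E: "E \<subseteq> nsets V 2"
    using assms by (auto simp: simple_graph_def)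
  obtain h where h: "bij_betw h V {0..<card V}"
    using ex_bij_betw_finite_nat[OF fin] by blast
  define f where "f e = Min (h ` e)" for e
  have f: "f e \<in> h ` e" if "e \<in> E" for e
    unfolding f_def using that E by (intro Min_in) (auto simp: nsets_def)
  have "f e < card V" if "e \<in> E" for e
  proof -
    have "h ` e \<subseteq> {0..<card V}"
      using E that h by (auto simp: nsets_def bij_betw_def)
    then show ?thesis
      using f[OF that] by auto
  qed
  moreover have "forest {e \<in> E. f e = i}" for i
  proof (rule star_imp_forest)
    fix e
    assume e: "e \<in> {e \<in> E. f e = i}"
    then obtain c where c: "c \<in> e" "h c = i"
      using f by force
    moreover have "c \<in> V"
      using E e c by (auto simp: nsets_def)
    \<comment> \<open>The centre of the star of colour \<open>i\<close> is the vertex numbered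
      \<open>i\<close>.\<close>
    ultimately show "the_inv_into V h i \<in> e"
      using h by (auto simp: bij_betw_def the_inv_into_f_f)
  qed
  ultimately show ?thesis
    unfolding arboricity_def by (intro Least_le) auto
qed

section \<open>Degrees and edge counts\<close>

lemma nbrs_subset: "E \<subseteq> nsets V 2 \<Longrightarrow> nbrs E v \<subseteq> V - {v}"
  using doubleton_in_nsets_2[of v _ V] by (force simp: nbrs_def simp del: doubleton_in_nsets_2)

lemma card_nbrs_le_max_degree:
  assumes "finite V" "v \<in> V"
  shows "card (nbrs E v) \<le> max_degree V E"
  unfolding max_degree_def using assms by (intro Max_ge) auto

text \<open>The handshake lemma, by double counting incidences: a neighbour \<open>w\<close>
  corresponds to the edge \<open>{v, w}\<close> at \<open>v\<close>, and each edge has two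
  ends.\<close>

lemma sum_card_nbrs:
  assumes "simple_graph V E"
  shows "(\<Sum>v\<in>V. card (nbrs E v)) = 2 * card E"
proof -
  have fin: "finite V" and E: "E \<subseteq> nsets V 2"
    using assms by (auto simp: simple_graph_def)
  have "card (nbrs E v) = card {e \<in> E. v \<in> e}" for v
  proof (rule bij_betw_same_card[of "\<lambda>w. {v, w}"])
    show "bij_betw (\<lambda>w. {v, w}) (nbrs E v) {e \<in> E. v \<in> e}"
      unfolding bij_betw_def
    proof
      show "inj_on (\<lambda>w. {v, w}) (nbrs E v)"
        by (auto simp: inj_on_def doubleton_eq_iff)
      show "(\<lambda>w. {v, w}) ` nbrs E v = {e \<in> E. v \<in> e}"
      proof
        show "{e \<in> E. v \<in> e} \<subseteq> (\<lambda>w. {v, w}) ` nbrs E v"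
        proof
          fix e
          assume e: "e \<in> {e \<in> E. v \<in> e}"
          then have "e \<in> nsets V 2"
            using E by blast
          then obtain x y where "e = {x, y}"
            by (rule nsets2_E)
          then show "e \<in> (\<lambda>w. {v, w}) ` nbrs E v"
            using e by (auto simp: nbrs_def insert_commute)
        qed
      qed (auto simp: nbrs_def)
    qed
  qed
  moreover have "(\<Sum>v\<in>V. card {e \<in> E. v \<in> e}) = 2 * card E"
  proof (rule sum_multicount)
    show "finite E"
      using finite_subset[OF E finite_imp_finite_nsets[OF fin]] .
    show "\<forall>e\<in>E. card {v \<in> V. v \<in> e} = 2"
    proof
      fix e
      assume "e \<in> E"
      then have "e \<subseteq> V" "card e = 2"
        using E by (auto simp: nsets_def)
      moreover from this have "{v \<in> V. v \<in> e} = e"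
        by auto
      ultimately show "card {v \<in> V. v \<in> e} = 2"
        by simp
    qed
  qed (rule fin)
  ultimately show ?thesis
    by simp
qed

section \<open>Maximal cliques before and after the insertion\<close>

lemma finite_max_cliques: "finite V \<Longrightarrow> finite (max_cliques V E)"
  by (rule finite_subset[of _ "Pow V"]) (auto simp: max_cliques_def)

text \<open>Among the finitely many cliques above \<open>K\<close> one is maximal. This later
  provides a maximal clique through an inserted edge.\<close>

lemma max_cliques_extend:
  assumes "finite V" "K \<subseteq> V" "clique K E"
  obtains C where "C \<in> max_cliques V E" "K \<subseteq> C"
proof -
  let ?S = "{C. C \<subseteq> V \<and> clique C E \<and> K \<subseteq> C}"
  have "finite ?S"
    by (rule finite_subset[of _ "Pow V"]) (use assms in auto)
  moreover have "K \<in> ?S"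
    using assms by simp
  ultimately have "\<exists>C\<in>?S. K \<subseteq> C \<and> (\<forall>D\<in>?S. C \<subseteq> D \<longrightarrow> C = D)"
    by (rule finite_has_maximal2)
  then obtain C where C: "C \<in> ?S" "K \<subseteq> C" "\<forall>D\<in>?S. C \<subseteq> D \<longrightarrow> C = D"
    by blast
  have "\<not> C \<subset> D" if "D \<subseteq> V" "clique D E" for D
    using C that by blast
  then have "C \<in> max_cliques V E"
    using C(1) unfolding max_cliques_def by simp
  then show thesis
    using C(2) by (rule that)
qed

text \<open>A clique avoiding every inserted edge is already a clique of \<open>E\<close>, and it
  stays maximal there since cliques of \<open>E\<close> are cliques of \<open>E \<union> H\<close>.
  Conversely, an inserted edge is missing from \<open>E\<close>, so a set containing it was not a
  clique before.\<close>

lemma new_cliques_eq: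
  assumes "E \<subseteq> nsets V 2" "H \<subseteq> nsets V 2" "H \<inter> E = {}"
  shows "new_cliques V E H = {C \<in> max_cliques V (E \<union> H). \<exists>e\<in>H. e \<subseteq> C}"
proof (intro equalityI subsetI)
  fix C
  assume C: "C \<in> new_cliques V E H"
  have "\<exists>e\<in>H. e \<subseteq> C"
  proof (rule ccontr)
    assume no: "\<not> (\<exists>e\<in>H. e \<subseteq> C)"
    have CV: "C \<subseteq> V" "clique C (E \<union> H)"
      using C by (auto simp: new_cliques_def max_cliques_def)
    have "clique C E"
      unfolding clique_def
    proof (intro ballI impI)
      fix v w
      assume "v \<in> C" "w \<in> C" "v \<noteq> w"
      then have "{v, w} \<in> E \<union> H" "{v, w} \<subseteq> C"
        using CV by (auto simp: clique_def)
      then show "{v, w} \<in> E"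
        using no by blast
    qed
    moreover have "\<not> C \<subset> D" if "D \<subseteq> V" "clique D E" for D
    proof -
      have "clique D (E \<union> H)"
        using that(2) by (auto simp: clique_def)
      then show ?thesis
        using C that(1) by (auto simp: new_cliques_def max_cliques_def)
    qed
    ultimately have "C \<in> max_cliques V E"
      using CV(1) by (simp add: max_cliques_def)
    then show False
      using C by (simp add: new_cliques_def)
  qed
  then show "C \<in> {C \<in> max_cliques V (E \<union> H). \<exists>e\<in>H. e \<subseteq> C}"
    using C by (simp add: new_cliques_def)
next
  fix C
  assume "C \<in> {C \<in> max_cliques V (E \<union> H). \<exists>e\<in>H. e \<subseteq> C}"
  then obtain e where C: "C \<in> max_cliques V (E \<union> H)" and e: "e \<in> H" "e \<subseteq> C"
    by blast
  from e assms(2) have "e \<in> nsets V 2"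
    by blast
  then obtain x y where xy: "e = {x, y}" "x \<noteq> y"
    by (rule nsets2_E)
  have "\<not> clique C E"
    using xy e assms(3) by (auto simp: clique_def)
  then show "C \<in> new_cliques V E H"
    using C by (simp add: new_cliques_def max_cliques_def)
qed

text \<open>A clique through \<open>u\<close> and \<open>v\<close> lies in the closed common neighbourhood of \<open>u\<close> and \<open>v\<close>,
  and there every maximal clique contains \<open>u\<close> and \<open>v\<close>.\<close>

lemma max_cliques_common_nbrs:
  assumes "E \<subseteq> nsets V 2" "{u, v} \<in> E" and W: "W = {u, v} \<union> (nbrs E u \<inter> nbrs E v)"
  shows "max_cliques W {e \<in> E. e \<subseteq> W} = {C \<in> max_cliques V E. {u, v} \<subseteq> C}"
proof -
  have uv: "u \<in> V" "v \<in> V" "u \<noteq> v" "{v, u} \<in> E"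
    using subsetD[OF assms(1,2)] assms(2) by (simp_all add: insert_commute)
  have WV: "W \<subseteq> V"
    using nbrs_subset[OF assms(1)] uv unfolding W by blast
  have cl: "clique D {e \<in> E. e \<subseteq> W} \<longleftrightarrow> clique D E" if "D \<subseteq> W" for D
    using that by (auto simp: clique_def)
  have in_W: "D \<subseteq> W" if "clique D E" "{u, v} \<subseteq> D" for D
  proof
    fix x
    assume "x \<in> D"
    then show "x \<in> W"
      using that unfolding W by (cases "x = u \<or> x = v") (auto simp: clique_def nbrs_def)
  qed
  \<comment> \<open>Every other vertex of \<open>W\<close> is adjacent to both \<open>u\<close> and
    \<open>v\<close>, so adding these two to a clique inside \<open>W\<close> gives a clique again;
    maximality then forces them into every maximal clique of \<open>W\<close>.\<close>
  have ext: "clique (D \<union> {u, v}) E" if "D \<subseteq> W" "clique D E" for D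
    unfolding clique_def
  proof (intro ballI impI)
    fix x y
    assume xy: "x \<in> D \<union> {u, v}" "y \<in> D \<union> {u, v}" "x \<noteq> y"
    then have "x \<in> W" "y \<in> W"
      using that(1) by (auto simp: W)
    show "{x, y} \<in> E"
    proof (cases "x \<in> {u, v} \<or> y \<in> {u, v}")
      case True
      then show ?thesis
        using \<open>x \<in> W\<close> \<open>y \<in> W\<close> xy(3) assms(2) unfolding W by (auto simp: nbrs_def insert_commute)
    next
      case False
      then show ?thesis
        using xy that(2) by (auto simp: clique_def)
    qed
  qed
  show ?thesis
  proof (intro equalityI subsetI)
    fix C
    assume "C \<in> max_cliques W {e \<in> E. e \<subseteq> W}"
    then have C: "C \<subseteq> W" "clique C E"
      and max: "\<And>D. D \<subseteq> W \<Longrightarrow> clique D E \<Longrightarrow> \<not> C \<subset> D"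
      using cl by (auto simp: max_cliques_def)
    have "C \<union> {u, v} \<subseteq> W"
      using C by (auto simp: W)
    from max[OF this ext[OF C]] have uvC: "{u, v} \<subseteq> C"
      by blast
    \<comment> \<open>A larger clique of the whole graph also contains \<open>u\<close> and
      \<open>v\<close>, hence lies in \<open>W\<close>, where \<open>C\<close> is maximal.\<close>
    have "\<not> C \<subset> D" if "D \<subseteq> V" "clique D E" for D
      using max[OF in_W[of D]] that uvC by blast
    then show "C \<in> {C \<in> max_cliques V E. {u, v} \<subseteq> C}"
      using C WV uvC by (auto simp: max_cliques_def)
  next
    fix C
    assume C: "C \<in> {C \<in> max_cliques V E. {u, v} \<subseteq> C}"
    then have "C \<subseteq> W"
      using in_W by (auto simp: max_cliques_def)
    moreover from this have "clique C {e \<in> E. e \<subseteq> W}"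
      using C cl[of C] by (simp add: max_cliques_def)
    moreover have "\<not> C \<subset> D" if "D \<subseteq> W" "clique D {e \<in> E. e \<subseteq> W}" for D
      using C WV that cl[of D] by (auto simp: max_cliques_def)
    ultimately show "C \<in> max_cliques W {e \<in> E. e \<subseteq> W}"
      by (simp add: max_cliques_def)
  qed
qed


section \<open>Labelled adjacency lists\<close>

definition edge :: "'a \<times> 'a \<Rightarrow> 'a set" where
  "edge e = {fst e, snd e}"

text \<open>Invariant of the insertion phase, with \<open>es\<close> the edges inserted so far.
  Equality of the sets makes the label test both sound and complete; distinctness identifies the
  length of a list with a degree.\<close>

definition labelled :: "'a adjacency \<Rightarrow> 'a set \<Rightarrow> 'a set set \<Rightarrow> ('a \<times> 'a) list \<Rightarrow> bool" where
  "labelled A V E es \<longleftrightarrow> (\<forall>x\<in>V. distinct (map fst (A x)) \<and>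
     set (A x) = {(y, None) |y. {x, y} \<in> E} \<union>
       {(y, Some j) |y j. j < length es \<and> edge (es ! j) = {x, y}})"

lemma represents_imp_labelled:
  assumes "represents A V E"
  shows "labelled A V E []"
  unfolding labelled_def
proof
  fix x
  assume "x \<in> V"
  then have A: "distinct (map fst (A x))" "fst ` set (A x) = nbrs E x" "\<forall>z\<in>set (A x). snd z = None"
    using assms by (auto simp: represents_def)
  have "set (A x) = (\<lambda>y. (y, None)) ` fst ` set (A x)"
    using A(3) by (force simp: image_image)
  then have "set (A x) = {(y, None) |y. {x, y} \<in> E}"
    unfolding A(2) by (auto simp: nbrs_def)
  then show "distinct (map fst (A x)) \<and> set (A x) = {(y, None) |y. {x, y} \<in> E} \<union>
       {(y, Some j) |y j. j < length [] \<and> edge ([] ! j) = {x, y}}"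
    using A(1) by simp
qed

text \<open>Appending to \<open>es\<close> leaves earlier positions unchanged, so old labels remain
  correct. As the edge is absent so far, neither list gets a repeated neighbour.\<close>

lemma labelled_insert_edge:
  assumes A: "labelled A V E es" and uv: "{u, v} \<in> nsets V 2" "{u, v} \<notin> E" "{u, v} \<notin> edge ` set es"
  shows "labelled (A(u := (v, Some (length es)) # A u, v := (u, Some (length es)) # A v))
    V E (es @ [(u, v)])"
    (is "labelled ?A V E ?es")
  unfolding labelled_def
proof
  fix x
  assume x: "x \<in> V"
  have "u \<noteq> v"
    using uv(1) by auto
  have D: "distinct (map fst (A x))"
    and S: "set (A x) = {(y, None) |y. {x, y} \<in> E} \<union>
       {(y, Some j) |y j. j < length es \<and> edge (es ! j) = {x, y}}"
    using A x unfolding labelled_def by blast+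
  have new: "{(y, Some j) |y j. j < length ?es \<and> edge (?es ! j) = {x, y}} =
      {(y, Some j) |y j. j < length es \<and> edge (es ! j) = {x, y}} \<union>
      {(y, Some (length es)) |y. {u, v} = {x, y}}"
    by (simp add: less_Suc_eq nth_append edge_def conj_disj_distribR ex_disj_distrib Collect_disj_eq
        cong: conj_cong) (auto simp: edge_def)
  have notin: "y \<notin> fst ` set (A x)" if "{u, v} = {x, y}" for y
  proof
    assume "y \<in> fst ` set (A x)"
    then have "{x, y} \<in> E \<or> {x, y} \<in> edge ` set es"
      unfolding S by force
    then show False
      using uv that by simp
  qed
  consider "x = u" | "x = v" | "x \<noteq> u" "x \<noteq> v"
    by blast
  then show "distinct (map fst (?A x)) \<and> set (?A x) = {(y, None) |y. {x, y} \<in> E} \<union>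
       {(y, Some j) |y j. j < length ?es \<and> edge (?es ! j) = {x, y}}"
  proof cases
    case 1
    then have "?A x = (v, Some (length es)) # A x"
      using \<open>u \<noteq> v\<close> by simp
    moreover have "{(y, Some (length es)) |y. {u, v} = {x, y}} = {(v, Some (length es))}"
      using 1 \<open>u \<noteq> v\<close> by (auto simp: doubleton_eq_iff)
    ultimately show ?thesis
      unfolding new using 1 D S notin[of v] by simp
  next
    case 2
    then have "?A x = (u, Some (length es)) # A x"
      using \<open>u \<noteq> v\<close> by simp
    moreover have "{(y, Some (length es)) |y. {u, v} = {x, y}} = {(u, Some (length es))}"
      using 2 \<open>u \<noteq> v\<close> by (auto simp: doubleton_eq_iff)
    ultimately show ?thesis
      unfolding new using 2 D S notin[of u] by (simp add: insert_commute)
  next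
    case 3
    then have "{(y, Some (length es)) |y. {u, v} = {x, y}} = {}"
      by (auto simp: doubleton_eq_iff)
    then show ?thesis
      unfolding new using 3 D S by simp
  qed
qed

text \<open>Induction over the remaining edges with the inserted prefix \<open>pre\<close> as a
  parameter, since the next label is \<open>length pre\<close>. An edge costs five steps: one for
  the loop, two charged for the update and two for the new cells.\<close>

lemma runs_within_insert_edges:
  assumes "labelled A V E pre" "distinct (map edge (pre @ es))"
    "edge ` set es \<subseteq> nsets V 2" "edge ` set es \<inter> E = {}"
  shows "\<exists>A'. runs_within (insert_edges (length pre) es A) A' []
      (5 * length es) (2 * length es) (2 * length es) \<and> labelled A' V E (pre @ es)"
  using assms
proof (induction es arbitrary: A pre)
  case Nil
  then show ?case
    using runs_within_return[of A] by auto
next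
  case (Cons e es)
  obtain u v where e: "e = (u, v)"
    by fastforce
  let ?A = "A(u := (v, Some (length pre)) # A u, v := (u, Some (length pre)) # A v)"
  have "labelled ?A V E (pre @ [e])"
    unfolding e by (rule labelled_insert_edge[OF Cons.prems(1)])
      (use Cons.prems(2-) in \<open>auto simp: e edge_def\<close>)
  then obtain A' where A': "runs_within (insert_edges (length (pre @ [e])) es ?A) A' []
      (5 * length es) (2 * length es) (2 * length es)" "labelled A' V E ((pre @ [e]) @ es)"
    using Cons.IH[of ?A "pre @ [e]"] Cons.prems(2-) by (auto simp del: fun_upd_apply)
  have "runs_within (insert_edges (length pre) (e # es) A) A' []
      (5 * length (e # es)) (2 * length (e # es)) (2 * length (e # es))"
    unfolding insert_edges.simps e
    by (rule runs_within_weaken, rule runs_within_bind, rule runs_within_charge,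
        rule runs_within_bind, rule runs_within_insert_edge, use A'(1) in simp) auto
  then show ?case
    using A'(2) by auto
qed

text \<open>Here \<open>A\<close> is the array after all insertions, the fixed data on which the
  loop over the inserted edges works.\<close>

locale edge_insertion =
  fixes V :: "'a set" and E :: "'a set set" and es :: "('a \<times> 'a) list" and A :: "'a adjacency"
  assumes simple: "simple_graph V E"
    and edges: "edge ` set es \<subseteq> nsets V 2"
    and disjoint: "edge ` set es \<inter> E = {}"
    and labelled: "labelled A V E es"
begin

abbreviation E' :: "'a set set" where
  "E' \<equiv> E \<union> edge ` set es"

abbreviation \<Delta> :: nat where
  "\<Delta> \<equiv> max_degree V E'"

abbreviation new :: "'a set set" where
  "new \<equiv> new_cliques V E (edge ` set es)"

section \<open>Adjacency lists of the enlarged graph\<close>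

lemma finite_V: "finite V"
  using simple by (simp add: simple_graph_def)

lemma E'_subset: "E' \<subseteq> nsets V 2"
  using simple edges by (simp add: simple_graph_def)

lemma simple_E': "simple_graph V E'"
  using finite_V E'_subset by (simp add: simple_graph_def)

lemma finite_E': "finite E'"
  by (rule finite_subset[OF E'_subset finite_imp_finite_nsets[OF finite_V]])

lemma adj_entries:
  assumes "x \<in> V"
  shows "set (A x) = {(y, None) |y. {x, y} \<in> E} \<union>
      {(y, Some j) |y j. j < length es \<and> edge (es ! j) = {x, y}}"
  using labelled assms by (simp add: labelled_def)

lemma distinct_adj: "x \<in> V \<Longrightarrow> distinct (map fst (A x))"
  using labelled by (simp add: labelled_def)

lemma fst_adj:
  assumes "x \<in> V"
  shows "fst ` set (A x) = nbrs E' x"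
proof -
  have "{x, y} \<in> edge ` set es \<longleftrightarrow> (\<exists>j<length es. edge (es ! j) = {x, y})" for y
    by (metis (no_types, lifting) image_iff in_set_conv_nth)
  moreover have "y \<in> fst ` set (A x) \<longleftrightarrow> (\<exists>l. (y, l) \<in> set (A x))" for y
    by force
  ultimately have "y \<in> fst ` set (A x) \<longleftrightarrow> y \<in> nbrs E' x" for y
    by (auto simp: adj_entries[OF assms] nbrs_def)
  then show ?thesis
    by blast
qed

lemma length_adj:
  assumes "x \<in> V"
  shows "length (A x) = card (nbrs E' x)"
  using distinct_card[OF distinct_adj[OF assms]] fst_adj[OF assms] by simp

lemma length_adj_le: "x \<in> V \<Longrightarrow> length (A x) \<le> \<Delta>"
  by (simp add: length_adj card_nbrs_le_max_degree finite_V)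

lemma sum_length_adj: "(\<Sum>x\<in>V. 1 + length (A x)) = card V + 2 * card E'"
  unfolding sum.distrib using sum_card_nbrs[OF simple_E'] by (simp add: length_adj)

lemma sum_length_adj_le:
  assumes "X \<subseteq> V"
  shows "(\<Sum>x\<in>X. 1 + length (A x)) \<le> card V + 2 * card E'"
  unfolding sum_length_adj[symmetric] by (rule sum_mono2[OF finite_V assms]) simp

text \<open>Each vertex of \<open>c\<close> costs one scan of its adjacency list, and each cell at
  most one scan of \<open>c\<close>; the number of inserted edges does not enter.\<close>

lemma runs_within_contains_earlier:
  assumes c: "set c \<subseteq> V" and i: "i \<le> length es"
  shows "runs_within (contains_earlier A i c) (\<exists>j<i. edge (es ! j) \<subseteq> set c) []
    (length c * (2 + \<Delta> * (length c + 1))) 0 0"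
proof -
  define P where "P = (\<lambda>(y, l). case l of None \<Rightarrow> False | Some j \<Rightarrow> j < i \<and> y \<in> set c)"
  let ?f = "\<lambda>(y, l). case l of None \<Rightarrow> ret False
       | Some j \<Rightarrow> if j < i then exists_in (\<lambda>z. ret (y = z)) c else ret False"
  have f: "runs_within (?f z) (P z) [] (length c) 0 0" for z
  proof -
    obtain y l where z: "z = (y, l)"
      by fastforce
    have F: "runs_within (ret False) False [] (length c) 0 0"
      by (rule runs_within_weaken[OF runs_within_return]) auto
    show ?thesis
      using F runs_within_member[of y c] by (auto simp: z P_def split: option.split)
  qed
  have inner: "runs_within (exists_in ?f (A x)) (\<exists>z\<in>set (A x). P z) [] (\<Delta> * (length c + 1)) 0 0"
    if "x \<in> set c" for x
  proof -
    have "length (A x) \<le> \<Delta>"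
      using that c by (intro length_adj_le) auto
    then have "length (A x) * (length c + 1) \<le> \<Delta> * (length c + 1)"
      by (rule mult_right_mono) simp
    then show ?thesis
      by (intro runs_within_weaken[OF runs_within_exists_in[OF f]]) auto
  qed
  have "runs_within (do { cells \<leftarrow> lookup A x; exists_in ?f cells }) (\<exists>z\<in>set (A x). P z) []
      (1 + \<Delta> * (length c + 1)) 0 0" if "x \<in> set c" for x
    by (rule runs_within_weaken, rule runs_within_bind, rule runs_within_lookup, rule inner[OF that])
      auto
  from runs_within_exists_in[of c "\<lambda>x. do { cells \<leftarrow> lookup A x; exists_in ?f cells }"
      "\<lambda>x. \<exists>z\<in>set (A x). P z", OF this]
  have "runs_within (contains_earlier A i c) (\<exists>x\<in>set c. \<exists>z\<in>set (A x). P z) []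
    (length c * (2 + \<Delta> * (length c + 1))) 0 0"
    unfolding contains_earlier_def by simp
  moreover have "(\<exists>x\<in>set c. \<exists>z\<in>set (A x). P z) \<longleftrightarrow> (\<exists>j<i. edge (es ! j) \<subseteq> set c)"
  proof
    assume "\<exists>x\<in>set c. \<exists>z\<in>set (A x). P z"
    then obtain x z where x: "x \<in> set c" and z: "z \<in> set (A x)" "P z"
      by blast
    from z(2) obtain y j where yj: "z = (y, Some j)" "j < i" "y \<in> set c"
      by (cases z) (auto simp: P_def split: option.splits)
    then have "edge (es ! j) = {x, y}"
      using z(1) adj_entries[of x] x c by auto
    then show "\<exists>j<i. edge (es ! j) \<subseteq> set c"
      using x yj by auto
  next
    assume "\<exists>j<i. edge (es ! j) \<subseteq> set c"
    then obtain j where j: "j < i" "edge (es ! j) \<subseteq> set c"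
      by blast
    obtain x y where xy: "es ! j = (x, y)"
      by fastforce
    \<comment> \<open>Finding the edge at its first endpoint is enough;
      \<open>j < i \<le> length es\<close> guarantees that its label is present there.\<close>
    have "(y, Some j) \<in> set (A x)"
      using adj_entries[of x] xy j i c by (auto simp: edge_def)
    moreover have "P (y, Some j)" "x \<in> set c"
      using j xy by (auto simp: P_def edge_def)
    ultimately show "\<exists>x\<in>set c. \<exists>z\<in>set (A x). P z"
      by blast
  qed
  ultimately show ?thesis
    by simp
qed

text \<open>The uniform \<open>n\<close> replaces the length of \<open>c\<close> so that the loop
  rule applies to all generated cliques at once. The part \<open>1 + 2 * n\<close> pays for closing
  the region, storing the clique and writing it.\<close>

lemma runs_within_process_clique:
  assumes c: "set c \<subseteq> V" "length c \<le> n" and i: "i \<le> length es"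
  shows "runs_within (process_clique A i c) ()
    (if \<exists>j<i. edge (es ! j) \<subseteq> set c then [] else [c]) (1 + 2 * n + n * (2 + \<Delta> * (n + 1))) 0 n"
proof -
  let ?b = "\<exists>j<i. edge (es ! j) \<subseteq> set c"
  have "length c * (2 + \<Delta> * (length c + 1)) \<le> n * (2 + \<Delta> * (n + 1))"
    using c(2) by (intro mult_mono add_mono) auto
  then have b: "runs_within (contains_earlier A i c) ?b [] (n * (2 + \<Delta> * (n + 1))) 0 0"
    by (intro runs_within_weaken[OF runs_within_contains_earlier[OF c(1) i]]) auto
  have "runs_within (if ?b then ret () else emit c) () (if ?b then [] else [c]) n 0 0"
    using runs_within_weaken[OF runs_within_return, of "[]" n 0 0 "()"]
      runs_within_weaken[OF runs_within_emit, of c "[c]" n 0 0] c(2) by auto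
  from runs_within_bind[where f = "\<lambda>b. if b then ret () else emit c", OF b this]
  have "runs_within (do { b \<leftarrow> contains_earlier A i c; if b then ret () else emit c }) ()
      (if ?b then [] else [c]) (n + n * (2 + \<Delta> * (n + 1))) 0 0"
    by (rule runs_within_weaken) auto
  note rest = this
  show ?thesis
    unfolding process_clique_def
    by (rule runs_within_weaken, rule runs_within_region, rule runs_within_bind,
        rule runs_within_alloc, rule rest) (use c(2) in auto)
qed

end


section \<open>Cost and output of EnumN\<close>

text \<open>Applied with \<open>d\<close> the maximum degree, \<open>n\<close> the size of the
  induced subgraph, \<open>\<mu>\<close> its number of maximal cliques, \<open>k\<close> the number
  of new cliques and \<open>s\<close> the steps of MCE. Lower powers of \<open>d\<close> are raised
  to \<open>d ^ 3\<close>; this gives 23 for the preparation, 16 for each clique, and 8 from the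
  cube of \<open>2 * d\<close>.\<close>

lemma steps_arith:
  fixes c d k n s l \<mu> :: nat
  assumes "1 \<le> d" "n \<le> 2 * d" "\<mu> \<le> k" "1 \<le> k" "s \<le> c * (n * (n * n) * \<mu>)"
  shows "6 + d * (d + 2) + n * (3 + d * (n + 2))
      + (s + \<mu> * (1 + 2 * n + n * (2 + d * (n + 1)) + 1)) \<le> (41 + 8 * c) * (d ^ 3 * k)"
proof -
  have d: "d \<le> d ^ 3" "d * d \<le> d ^ 3" "1 \<le> d ^ 3"
    using assms(1) power_increasing[of 1 3 d] power_increasing[of 2 3 d] power_increasing[of 0 3 d]
    by (simp_all add: power2_eq_square)
  have dk: "d ^ 3 \<le> d ^ 3 * k"
    using assms(4) by simp
  have "n * (3 + d * (n + 2)) \<le> 2 * d * (3 + d * (2 * d + 2))"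
    using assms(2) by (intro mult_mono add_mono) auto
  also have "\<dots> = 6 * d + 4 * d ^ 3 + 4 * (d * d)"
    by (simp add: algebra_simps power3_eq_cube)
  finally have 1: "n * (3 + d * (n + 2)) \<le> 14 * d ^ 3"
    using d by linarith
  have "n * (2 + d * (n + 1)) \<le> 2 * d * (2 + d * (2 * d + 1))"
    using assms(2) by (intro mult_mono add_mono) auto
  also have "\<dots> = 4 * d + 4 * d ^ 3 + 2 * (d * d)"
    by (simp add: algebra_simps power3_eq_cube)
  finally have "1 + 2 * n + n * (2 + d * (n + 1)) + 1 \<le> 16 * d ^ 3"
    using d assms(2) by linarith
  then have 2: "\<mu> * (1 + 2 * n + n * (2 + d * (n + 1)) + 1) \<le> k * (16 * d ^ 3)"
    using assms(3) by (intro mult_mono) auto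
  have "s \<le> c * (n * (n * n) * \<mu>)"
    by (rule assms(5))
  also have "\<dots> \<le> c * (2 * d * (2 * d * (2 * d)) * k)"
    using assms(2,3) by (intro mult_left_mono mult_mono) auto
  also have "\<dots> = 8 * c * (d ^ 3 * k)"
    by (simp add: algebra_simps power3_eq_cube)
  finally have 3: "s \<le> 8 * c * (d ^ 3 * k)" .
  have "d * (d + 2) = d * d + 2 * d"
    by (simp add: algebra_simps)
  then have "6 + d * (d + 2) + n * (3 + d * (n + 2)) \<le> 23 * (d ^ 3 * k)"
    using 1 d dk by linarith
  then show ?thesis
    using 2 3 by (simp add: algebra_simps)
qed

section \<open>Processing the inserted edges\<close>

context edge_insertion
begin

text \<open>Bounds the number of cliques that MCE generates for one inserted edge by the number of
  new cliques.\<close>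

lemma edge_subset_new:
  assumes "e \<in> edge ` set es"
  shows "{C \<in> max_cliques V E'. e \<subseteq> C} \<subseteq> new"
  using assms new_cliques_eq[of E V "edge ` set es"] simple edges disjoint
  by (auto simp: simple_graph_def)

lemma finite_new: "finite new"
  by (simp add: new_cliques_def finite_max_cliques finite_V)

lemma max_degree_pos:
  assumes "e \<in> edge ` set es"
  shows "1 \<le> \<Delta>"
proof -
  have "e \<in> nsets V 2"
    using edges assms by blast
  then obtain u v where uv: "e = {u, v}" "u \<in> V"
    by (rule nsets2_E)
  then have "v \<in> nbrs E' u"
    using assms by (simp add: nbrs_def)
  then have "0 < length (A u)"
    using fst_adj[OF uv(2)] by force
  then show ?thesis
    using length_adj_le[OF uv(2)] by linarith
qed

text \<open>An inserted edge is itself a clique, and any maximal clique above it is new. With this,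
  costs independent of the number of cliques fit into the product bound.\<close>

lemma card_new_pos:
  assumes "e \<in> edge ` set es"
  shows "1 \<le> card new"
proof -
  have "e \<in> nsets V 2"
    using edges assms by blast
  then obtain u v where uv: "e = {u, v}" "u \<in> V" "v \<in> V"
    by (rule nsets2_E)
  then have "clique e E'"
    using assms by (auto simp: clique_def insert_commute)
  then obtain C where "C \<in> max_cliques V E'" "e \<subseteq> C"
    using max_cliques_extend[OF finite_V, of e E'] uv by auto
  then have "new \<noteq> {}"
    using edge_subset_new[OF assms] by blast
  then show ?thesis
    using finite_new by (simp add: Suc_le_eq card_gt_0_iff)
qed

text \<open>The output is characterised by \<open>i\<close> being the first position whose edge lies
  in the clique, which makes the outputs for different edges disjoint.\<close>

lemma exists_process_edge:
  assumes mce: "\<And>X V E. is_graph_list X V E \<Longrightarrow>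
        (\<forall>c\<in>set (generated (mce X)). distinct c) \<and>
        distinct (map set (generated (mce X))) \<and>
        set ` set (generated (mce X)) = max_cliques V E"
    and steps: "\<And>X V E. is_graph_list X V E \<Longrightarrow> E \<noteq> {} \<Longrightarrow>
        steps (mce X) \<le> Ct * (arboricity E * card E * card (max_cliques V E))"
    and workspace: "\<And>X V E. is_graph_list X V E \<Longrightarrow> E \<noteq> {} \<Longrightarrow>
        workspace (mce X) \<le> Cs * (card V + card E)"
    and i: "i < length es"
  shows "\<exists>os. runs_within (process_edge mce A i (es ! i)) () os ((41 + 8 * Ct) * (\<Delta> ^ 3 * card new))
      0 ((4 + Cs) * (card V + 2 * card E')) \<and>
    distinct (map set os) \<and>
    set ` set os = {C \<in> max_cliques V E'. edge (es ! i) \<subseteq> C \<and> (\<forall>j<i. \<not> edge (es ! j) \<subseteq> C)}"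
proof -
  obtain u v where uv: "es ! i = (u, v)"
    by fastforce
  have e: "edge (es ! i) = {u, v}" "{u, v} \<in> edge ` set es"
    using uv nth_mem[OF i] by (force simp: edge_def)+
  then have V: "u \<in> V" "v \<in> V" "u \<noteq> v"
    using edges subsetD[OF edges e(2)] by simp_all
  \<comment> \<open>\<open>common\<close> and \<open>X\<close> are literally the lists that the
    program computes; the reversals come from the accumulators.\<close>
  define common where "common = rev (filter (\<lambda>y. y \<in> fst ` set (A v)) (map fst (A u)))"
  define W where "W = u # v # common"
  define X where "X = rev (map (\<lambda>x. (x, rev (filter (\<lambda>y. y \<in> set W) (map fst (A x))))) W)"
  define F where "F = {e \<in> E'. e \<subseteq> set W}"
  let ?g = "generated (mce X)" and ?S = "card V + 2 * card E'"

  have common: "set common = nbrs E' u \<inter> nbrs E' v"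
    using fst_adj[OF V(1)] fst_adj[OF V(2)] by (auto simp: common_def)
  then have W: "set W = {u, v} \<union> (nbrs E' u \<inter> nbrs E' v)"
    by (auto simp: W_def)
  have "nbrs E' u \<subseteq> V - {u}" "nbrs E' v \<subseteq> V - {v}"
    by (rule nbrs_subset[OF E'_subset])+
  then have WV: "set W \<subseteq> V" and dist_W: "distinct W"
    using V distinct_adj[OF V(1)] common W by (auto simp: W_def common_def)
  have "v \<in> nbrs E' u"
    using e(2) by (simp add: nbrs_def)
  have \<Delta>: "1 \<le> \<Delta>" and new: "1 \<le> card new"
    using max_degree_pos[OF e(2)] card_new_pos[OF e(2)] .
  have "finite (nbrs E' u)"
    using \<open>nbrs E' u \<subseteq> V - {u}\<close> finite_V finite_subset by blast
  \<comment> \<open>Since \<open>v\<close> is itself a neighbour of \<open>u\<close>, all of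
    \<open>W\<close> lies in the closed neighbourhood of \<open>u\<close>.\<close>
  have "length W = card (set W)"
    using dist_W by (simp add: distinct_card)
  also have "\<dots> \<le> card (insert u (nbrs E' u))"
    using W \<open>v \<in> nbrs E' u\<close> \<open>finite (nbrs E' u)\<close> by (intro card_mono) auto
  also have "\<dots> \<le> 1 + \<Delta>"
    using card_nbrs_le_max_degree[OF finite_V V(1), of E']
      \<open>finite (nbrs E' u)\<close> by (simp add: card_insert_if)
  finally have len_W: "length W \<le> 2 * \<Delta>"
    using \<Delta> by linarith

  have nbrs_F: "nbrs F x = nbrs E' x \<inter> set W" if "x \<in> set W" for x
    using that by (auto simp: nbrs_def F_def)
  have "F \<subseteq> nsets (set W) 2"
    using E'_subset by (auto simp: F_def nsets_def)
  then have simple_F: "simple_graph (set W) F"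
    by (simp add: simple_graph_def)
  have X: "is_graph_list X (set W) F"
    unfolding is_graph_list_def
  proof (intro conjI)
    show "distinct (map fst X)" "fst ` set X = set W"
      using dist_W by (auto simp: X_def rev_map comp_def image_image)
    show "\<forall>(x, ns)\<in>set X. distinct ns \<and> set ns = nbrs F x"
    proof clarify
      fix x ns
      assume "(x, ns) \<in> set X"
      then have x: "x \<in> set W" and ns: "ns = rev (filter (\<lambda>y. y \<in> set W) (map fst (A x)))"
        by (auto simp: X_def)
      then have "x \<in> V"
        using WV by blast
      then show "distinct ns \<and> set ns = nbrs F x"
        using distinct_adj[of x] fst_adj[of x] nbrs_F[OF x] unfolding ns by auto
    qed
  qed (rule simple_F)
  \<comment> \<open>The cost bounds of MCE presuppose an edge; \<open>{u, v}\<close> is one.\<close>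
  have "F \<noteq> {}"
    using e(2) by (auto simp: F_def W_def)
  \<comment> \<open>Counting ordered pairs is crude but sufficient: with arboricity at most
    \<open>length W\<close>, the cost of MCE per clique becomes cubic in
    \<open>length W\<close>.\<close>
  have "card F \<le> length W * length W"
  proof -
    have "card F \<le> card ((\<lambda>(x, y). {x, y}) ` (set W \<times> set W))"
    proof (rule card_mono)
      show "F \<subseteq> (\<lambda>(x, y). {x, y}) ` (set W \<times> set W)"
        using \<open>F \<subseteq> nsets (set W) 2\<close> by (auto simp: nsets_2_eq)
    qed simp
    also have "\<dots> \<le> card (set W \<times> set W)"
      by (rule card_image_le) simp
    also have "\<dots> = length W * length W"
      using dist_W by (simp add: distinct_card)
    finally show ?thesis .
  qed
  moreover have "arboricity F \<le> length W"
    using arboricity_le[OF simple_F] dist_W by (simp add: distinct_card)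
  ultimately have "arboricity F * card F * card (max_cliques (set W) F)
      \<le> length W * (length W * length W) * card (max_cliques (set W) F)"
    by (intro mult_mono) auto
  then have steps': "steps (mce X)
      \<le> Ct * (length W * (length W * length W) * card (max_cliques (set W) F))"
    using steps[OF X \<open>F \<noteq> {}\<close>] by (meson le_trans mult_le_mono2)
  have "card F \<le> card E'"
    by (rule card_mono[OF finite_E']) (auto simp: F_def)
  moreover have card_W: "length W \<le> card V"
    using card_mono[OF finite_V WV] dist_W by (simp add: distinct_card)
  ultimately have "Cs * (card (set W) + card F) \<le> Cs * ?S"
    using dist_W by (intro mult_left_mono) (auto simp: distinct_card)
  then have workspace': "workspace (mce X) \<le> Cs * ?S"
    using workspace[OF X \<open>F \<noteq> {}\<close>] by linarith

  have gen: "distinct (map set ?g)" "set ` set ?g = max_cliques (set W) F"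
    "\<And>c. c \<in> set ?g \<Longrightarrow> distinct c"
    using mce[OF X] by blast+
  have cliques: "max_cliques (set W) F = {C \<in> max_cliques V E'. {u, v} \<subseteq> C}"
    unfolding F_def by (rule max_cliques_common_nbrs[OF E'_subset _ W]) (use e(2) in simp)
  have len_g: "length ?g = card (max_cliques (set W) F)"
    using distinct_card[OF gen(1)] gen(2) by simp
  have \<mu>: "card (max_cliques (set W) F) \<le> card new"
    using edge_subset_new[OF e(2)] by (intro card_mono[OF finite_new]) (simp add: cliques)

  let ?n = "length W"
  let ?os = "\<lambda>c. if \<exists>j<i. edge (es ! j) \<subseteq> set c then [] else [c]"
  have process: "runs_within (process_clique A i c) () (?os c)
      (1 + 2 * ?n + ?n * (2 + \<Delta> * (?n + 1))) 0 ?n" if "c \<in> set ?g" for c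
  proof (rule runs_within_process_clique)
    have "set c \<subseteq> set W"
      using that gen(2) by (auto simp: max_cliques_def)
    then show "set c \<subseteq> V" "length c \<le> ?n"
      using WV gen(3)[OF that] dist_W card_mono[of "set W" "set c"] by (auto simp: distinct_card)
  qed (use i in simp)
  have run: "runs_within (run_mce mce X (process_clique A i)) () (concat (map ?os ?g))
      (steps (mce X) + length ?g * (1 + 2 * ?n + ?n * (2 + \<Delta> * (?n + 1)) + 1) + 1)
      0 (workspace (mce X) + ?n)"
    unfolding run_mce_def
    by (rule runs_within_weaken, rule runs_within_region, rule runs_within_bind,
        rule runs_within_charge, rule runs_within_bind, rule runs_within_reserve,
        rule runs_within_for_each, rule process) auto
  have len_A: "length (A x) \<le> \<Delta>" if "x \<in> set W" for x
    using that WV length_adj_le by blast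
  have "(\<exists>z\<in>set (A v). y = fst z) \<longleftrightarrow> y \<in> fst ` set (A v)" for y
    by blast
  then have member: "runs_within (exists_in (\<lambda>z. ret (y = fst z)) (A v)) (y \<in> fst ` set (A v)) []
      (length (A v)) 0 0" for y
    using runs_within_exists_in[of "A v" "\<lambda>z. ret (y = fst z)" "\<lambda>z. y = fst z", OF runs_within_return]
    by simp
  have select: "runs_within (select (\<lambda>y. exists_in (\<lambda>z. ret (y = fst z)) (A v)) (A u) []) common []
      (\<Delta> * (\<Delta> + 2)) (length (A u)) (length (A u))"
  proof (rule runs_within_weaken)
    show "runs_within (select (\<lambda>y. exists_in (\<lambda>z. ret (y = fst z)) (A v)) (A u) []) common []
      (length (A u) * (length (A v) + 2)) (length (A u)) (length (A u))"
      using runs_within_select[where P = "\<lambda>y. y \<in> fst ` set (A v)"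
          and p = "\<lambda>y. exists_in (\<lambda>z. ret (y = fst z)) (A v)" and acc = "[]", OF member]
      by (simp add: common_def)
    show "length (A u) * (length (A v) + 2) \<le> \<Delta> * (\<Delta> + 2)"
      using length_adj_le V by (intro mult_mono add_mono) auto
  qed auto
  have "(\<Sum>x\<leftarrow>W. 1 + length (A x)) = (\<Sum>x\<in>set W. 1 + length (A x))"
    using dist_W by (rule sum_list_distinct_conv_sum_set)
  also have "\<dots> \<le> ?S"
    by (rule sum_length_adj_le[OF WV])
  finally have sum_W: "(\<Sum>x\<leftarrow>W. 1 + length (A x)) \<le> ?S" .
  have induced: "runs_within (induced A W W []) X [] (?n * (3 + \<Delta> * (?n + 2))) ?S ?S"
    using runs_within_weaken[OF runs_within_induced[of W A \<Delta> W "[]", OF len_A]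
        refl order.refl sum_W sum_W]
    by (simp add: X_def)
  have S: "length (A u) \<le> ?S" "2 \<le> ?S"
    using sum_W by (auto simp: W_def)
  \<comment> \<open>The 6 consists of two lookups, the two cells for \<open>u\<close> and
    \<open>v\<close>, and the closing of two regions.\<close>
  have "runs_within (process_edge mce A i (u, v)) () (concat (map ?os ?g))
      (6 + \<Delta> * (\<Delta> + 2) + ?n * (3 + \<Delta> * (?n + 2))
        + (steps (mce X) + length ?g * (1 + 2 * ?n + ?n * (2 + \<Delta> * (?n + 1)) + 1)))
      0 (length (A u) + 2 + ?S + (workspace (mce X) + ?n))"
    unfolding process_edge_def prod.case Let_def
    by (rule runs_within_weaken, rule runs_within_region,
        rule runs_within_bind, rule runs_within_lookup, rule runs_within_bind, rule runs_within_lookup,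
        rule runs_within_bind, rule select, rule runs_within_bind, rule runs_within_alloc,
        fold W_def, rule runs_within_bind, rule induced, rule run) auto
  then have "runs_within (process_edge mce A i (u, v)) () (concat (map ?os ?g))
      ((41 + 8 * Ct) * (\<Delta> ^ 3 * card new)) 0 ((4 + Cs) * ?S)"
  proof (rule runs_within_weaken)
    show "6 + \<Delta> * (\<Delta> + 2) + ?n * (3 + \<Delta> * (?n + 2))
        + (steps (mce X) + length ?g * (1 + 2 * ?n + ?n * (2 + \<Delta> * (?n + 1)) + 1))
      \<le> (41 + 8 * Ct) * (\<Delta> ^ 3 * card new)"
      by (rule steps_arith[OF \<Delta> len_W]) (use \<mu> new steps' in \<open>simp_all only: len_g\<close>)
    show "length (A u) + 2 + ?S + (workspace (mce X) + ?n) \<le> (4 + Cs) * ?S"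
    proof -
      have "a + 2 + s + (w + n) \<le> (4 + c) * s" if "a \<le> s" "2 \<le> s" "w \<le> c * s" "n \<le> s"
        for a s w n c :: nat
        using that by (simp add: add_mult_distrib)
      then show ?thesis
        using S workspace' card_W by simp
    qed
  qed auto
  moreover have "concat (map ?os cs) = filter (\<lambda>c. \<not> (\<exists>j<i. edge (es ! j) \<subseteq> set c)) cs" for cs
    by (induction cs) auto
  moreover have "distinct (map set (filter P ?g))" for P
    using gen(1) by (rule distinct_map_filter)
  moreover have "set ` set (filter (\<lambda>c. \<not> (\<exists>j<i. edge (es ! j) \<subseteq> set c)) ?g) =
      {C \<in> set ` set ?g. \<forall>j<i. \<not> edge (es ! j) \<subseteq> C}"
    by auto
  ultimately show ?thesis
    unfolding gen(2) cliques e(1) unfolding uv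
    by (intro exI[of _ "concat (map ?os ?g)"] conjI) simp_all
qed

text \<open>Induction from the end of the list downwards, so that positions and labels stay
  absolute. Every edge releases its memory, hence \<open>q\<close> is not multiplied.\<close>

lemma exists_process_edges:
  assumes process: "\<And>i. i < length es \<Longrightarrow> \<exists>os. runs_within (process_edge mce A i (es ! i)) () os t 0 q \<and>
      distinct (map set os) \<and>
      set ` set os = {C \<in> max_cliques V E'. edge (es ! i) \<subseteq> C \<and> (\<forall>j<i. \<not> edge (es ! j) \<subseteq> C)}"
    and i: "i \<le> length es"
  shows "\<exists>os. runs_within (process_edges mce A i (drop i es)) () os ((length es - i) * (t + 1)) 0 q \<and>
      distinct (map set os) \<and>
      set ` set os = {C \<in> max_cliques V E'. \<exists>k. i \<le> k \<and> k < length es \<and> edge (es ! k) \<subseteq> C \<and>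
        (\<forall>j<k. \<not> edge (es ! j) \<subseteq> C)}"
  using i
proof (induction i rule: inc_induct)
  case base
  show ?case
    by (intro exI[of _ "[]"]) (auto intro: runs_within_weaken[OF runs_within_return])
next
  case (step i)
  obtain os1 where os1: "runs_within (process_edge mce A i (es ! i)) () os1 t 0 q"
      "distinct (map set os1)"
      "set ` set os1 = {C \<in> max_cliques V E'. edge (es ! i) \<subseteq> C \<and> (\<forall>j<i. \<not> edge (es ! j) \<subseteq> C)}"
    using process[OF step.hyps(2)] by blast
  obtain os2 where os2:
      "runs_within (process_edges mce A (Suc i) (drop (Suc i) es)) () os2
        ((length es - Suc i) * (t + 1)) 0 q"
      "distinct (map set os2)"
      "set ` set os2 = {C \<in> max_cliques V E'. \<exists>k. Suc i \<le> k \<and> k < length es \<and>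
        edge (es ! k) \<subseteq> C \<and> (\<forall>j<k. \<not> edge (es ! j) \<subseteq> C)}"
    using step.IH by blast
  have "drop i es = es ! i # drop (Suc i) es"
    using step.hyps(2) by (rule Cons_nth_drop_Suc[symmetric])
  moreover have "(length es - i) * (t + 1) = 1 + (t + (length es - Suc i) * (t + 1))"
    using step.hyps(2) by (simp add: Suc_diff_Suc[symmetric])
  ultimately have "runs_within (process_edges mce A i (drop i es)) () (os1 @ os2)
      ((length es - i) * (t + 1)) 0 q"
    by (simp only: process_edges.simps)
      (rule runs_within_weaken, rule runs_within_bind, rule runs_within_charge,
        rule runs_within_bind, rule os1(1), rule os2(1), auto)
  \<comment> \<open>A clique kept at a later position contains no earlier inserted edge, in
    particular not \<open>es ! i\<close>.\<close>
  moreover have "set ` set os1 \<inter> set ` set os2 = {}"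
    unfolding os1(3) os2(3) by auto
  then have "distinct (map set (os1 @ os2))"
    using os1(2) os2(2) by simp
  moreover have "set ` set (os1 @ os2) = {C \<in> max_cliques V E'. \<exists>k. i \<le> k \<and> k < length es \<and>
      edge (es ! k) \<subseteq> C \<and> (\<forall>j<k. \<not> edge (es ! j) \<subseteq> C)}"
  proof -
    have le: "i \<le> k \<longleftrightarrow> k = i \<or> Suc i \<le> k" for k
      by auto
    have "(\<exists>k. i \<le> k \<and> P k) \<longleftrightarrow> P i \<or> (\<exists>k. Suc i \<le> k \<and> P k)" for P
      unfolding le by blast
    then show ?thesis
      unfolding set_append image_Un os1(3) os2(3) using step.hyps(2) by auto
  qed
  ultimately show ?case
    by blast
qed

end

text \<open>Turns the union over all positions of the cliques kept there into the set of maximal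
  cliques with some inserted edge, since a nonempty set of positions has a least one.\<close>

lemma bex_set_iff_first_index:
  "(\<exists>x\<in>set xs. P x) \<longleftrightarrow> (\<exists>k. k < length xs \<and> P (xs ! k) \<and> (\<forall>j<k. \<not> P (xs ! j)))"
proof
  assume "\<exists>x\<in>set xs. P x"
  then have "\<exists>k. k < length xs \<and> P (xs ! k)"
    by (auto simp: in_set_conv_nth)
  then obtain k where "k < length xs" "P (xs ! k)" "\<forall>j<k. \<not> (j < length xs \<and> P (xs ! j))"
    unfolding exists_least_iff[of "\<lambda>k. k < length xs \<and> P (xs ! k)"] by blast
  then show "\<exists>k. k < length xs \<and> P (xs ! k) \<and> (\<forall>j<k. \<not> P (xs ! j))"
    by (intro exI[of _ k]) auto
qed auto

section \<open>Total output, time and space\<close>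

lemma run_EnumN_bounds:
  assumes "runs_within (EnumN mce A es) () os t m q"
  shows "out (run_EnumN mce V A es) = os"
    and "clock (run_EnumN mce V A es) \<le> t"
    and "peak (run_EnumN mce V A es) \<le> input_size V A es + q"
  using assms[unfolded runs_within_def, THEN spec, of "\<lparr>clock = 0, used = input_size V A es,
      peak = input_size V A es, out = []\<rparr>"]
  by (simp_all add: run_EnumN_def)

theorem theorem4:
  fixes mce :: "'a mce"
  assumes "MCE_spec mce"
  shows "\<exists>Ct Cs. \<forall>V E H es A.
    simple_graph V E \<and> H \<subseteq> nsets V 2 \<and> H \<inter> E = {} \<and> edge_order es H \<and> represents A V E \<longrightarrow>
      distinct (map set (out (run_EnumN mce V A es))) \<and>
      set ` set (out (run_EnumN mce V A es)) = new_cliques V E H \<and>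
      clock (run_EnumN mce V A es)
        \<le> Ct * (max_degree V (E \<union> H) ^ 3 * card H * card (new_cliques V E H)) \<and>
      peak (run_EnumN mce V A es) \<le> Cs * (card (E \<union> H) + card V)"
proof -
  note mce_spec = assms[unfolded MCE_spec_def]
  note mce = mce_spec[THEN conjunct1, rule_format]
  \<comment> \<open>The constants of MCE are fixed before any graph is chosen, so the resulting ones
    are uniform over all inputs.\<close>
  obtain Ct where Ct: "\<forall>X V E. is_graph_list X V E \<and> E \<noteq> {} \<longrightarrow>
      steps (mce X) \<le> Ct * (arboricity E * card E * card (max_cliques V E))"
    using mce_spec[THEN conjunct2, THEN conjunct1] by (rule exE)
  obtain Cs where Cs: "\<forall>X V E. is_graph_list X V E \<and> E \<noteq> {} \<longrightarrow>
      workspace (mce X) \<le> Cs * (card V + card E)"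
    using mce_spec[THEN conjunct2, THEN conjunct2] by (rule exE)
  note steps = Ct[rule_format, OF conjI] and workspace = Cs[rule_format, OF conjI]
  show ?thesis
  \<comment> \<open>To the 41 of one edge come five steps for its insertion and one for the loop.
    For space, the input takes at most \<open>card V + 3 * card E'\<close> cells, the insertions at
    most \<open>2 * card E'\<close>, and the edge loop
    \<open>(4 + Cs) * (card V + 2 * card E')\<close>, so \<open>card E'\<close> gets the factor
    \<open>13 + 2 * Cs\<close>.\<close>
  proof (rule exI[of _ "47 + 8 * Ct"], rule exI[of _ "13 + 2 * Cs"], intro allI impI, elim conjE)
    fix V :: "'a set" and E H es A
    assume VE: "simple_graph V E" and H: "H \<subseteq> nsets V 2" "H \<inter> E = {}"
      and es: "edge_order es H" and A: "represents A V E"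
    have edge: "(\<lambda>(u, v). {u, v}) = edge"
      by (auto simp: edge_def)
    have es': "distinct (map edge es)" "edge ` set es = H"
      using es unfolding edge_order_def edge by simp_all
    obtain A' where ins: "runs_within (insert_edges 0 es A) A' []
        (5 * length es) (2 * length es) (2 * length es)" and "labelled A' V E es"
      using runs_within_insert_edges[of A V E "[]" es] represents_imp_labelled[OF A] es' H by auto
    then interpret edge_insertion V E es A'
      using VE H es' by unfold_locales auto
    let ?K = "\<Delta> ^ 3 * card new" and ?S = "card V + 2 * card E'"
    have "\<exists>os. runs_within (process_edges mce A' 0 (drop 0 es)) () os
        ((length es - 0) * ((41 + 8 * Ct) * ?K + 1)) 0 ((4 + Cs) * ?S) \<and> distinct (map set os) \<and>
      set ` set os = {C \<in> max_cliques V E'. \<exists>k. 0 \<le> k \<and> k < length es \<and> edge (es ! k) \<subseteq> C \<and>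
        (\<forall>j<k. \<not> edge (es ! j) \<subseteq> C)}"
      by (rule exists_process_edges[OF exists_process_edge[OF mce steps workspace]]) simp_all
    then obtain os where run: "runs_within (process_edges mce A' 0 es) () os
        (length es * ((41 + 8 * Ct) * ?K + 1)) 0 ((4 + Cs) * ?S)"
      and dist: "distinct (map set os)"
      and "set ` set os = {C \<in> max_cliques V E'. \<exists>k. k < length es \<and> edge (es ! k) \<subseteq> C \<and>
        (\<forall>j<k. \<not> edge (es ! j) \<subseteq> C)}"
      by auto
    note this(3)
    also have "\<dots> = {C \<in> max_cliques V E'. \<exists>e\<in>H. e \<subseteq> C}"
      unfolding es'(2)[symmetric] bex_set_iff_first_index[of es "\<lambda>e. edge e \<subseteq> _", symmetric]
      by simp
    also have "\<dots> = new"
      using new_cliques_eq[of E V H] VE H by (simp add: es'(2) simple_graph_def)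
    finally have set_os: "set ` set os = new" .
    have "runs_within (EnumN mce A es) () os
        (5 * length es + length es * ((41 + 8 * Ct) * ?K + 1))
        (2 * length es) (2 * length es + (4 + Cs) * ?S)"
      unfolding EnumN_def
      by (rule runs_within_weaken, rule runs_within_bind, rule ins, rule run) auto
    then have result: "out (run_EnumN mce V A es) = os"
      "clock (run_EnumN mce V A es) \<le> 5 * length es + length es * ((41 + 8 * Ct) * ?K + 1)"
      "peak (run_EnumN mce V A es) \<le> input_size V A es + (2 * length es + (4 + Cs) * ?S)"
      by (rule run_EnumN_bounds)+
    have card_H: "card H = length es"
      using distinct_card[OF es'(1)] es'(2) by simp

    have "5 * length es + length es * ((41 + 8 * Ct) * ?K + 1)
        \<le> (47 + 8 * Ct) * (\<Delta> ^ 3 * card H * card new)"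
    \<comment> \<open>Without inserted edges the left side is 0; otherwise \<open>1 \<le> ?K\<close>
      absorbs the six extra steps per edge.\<close>
    proof (cases "es = []")
      case False
      then have "edge (hd es) \<in> edge ` set es"
        by simp
      then have "1 \<le> ?K"
        using max_degree_pos card_new_pos by (simp add: Suc_le_eq)
      then have "length es \<le> ?K * length es"
        by simp
      then show ?thesis
        unfolding card_H by (simp add: algebra_simps)
    qed simp
    with result(2) have time: "clock (run_EnumN mce V A es)
        \<le> (47 + 8 * Ct) * (\<Delta> ^ 3 * card H * card new)"
      by (rule order.trans)
    have "input_size V A es + (2 * length es + (4 + Cs) * ?S)
        \<le> (13 + 2 * Cs) * (card E' + card V)"
    proof -
      have "length (A x) = card (nbrs E x)" if "x \<in> V" for x
        using A that distinct_card[of "map fst (A x)"] by (auto simp: represents_def)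
      then have "input_size V A es = card V + 2 * card E + length es"
        unfolding input_size_def sum.distrib using sum_card_nbrs[OF VE] by simp
      moreover have "card E \<le> card E'" "length es \<le> card E'"
        using card_mono[OF finite_E', of E] card_mono[OF finite_E', of H] card_H es'(2) by auto
      ultimately show ?thesis
        by (simp add: algebra_simps)
    qed
    with result(3) have space: "peak (run_EnumN mce V A es) \<le> (13 + 2 * Cs) * (card E' + card V)"
      by (rule order.trans)
    show "distinct (map set (out (run_EnumN mce V A es))) \<and>
      set ` set (out (run_EnumN mce V A es)) = new_cliques V E H \<and>
      clock (run_EnumN mce V A es)
        \<le> (47 + 8 * Ct) * (max_degree V (E \<union> H) ^ 3 * card H * card (new_cliques V E H)) \<and>
      peak (run_EnumN mce V A es) \<le> (13 + 2 * Cs) * (card (E \<union> H) + card V)"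
      using dist set_os time space unfolding result(1) es'(2) by blast
  qed
qed

end
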